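(* Let $\mathcal{H}$ be a hypergraph and assume that $\emptyset$ is not an edge of $\mathcal{H}$. Let $p$ be a prime number. Then for every positive integer $t$ and every proper coloring $c$ of the Kneser hypergraph $\operatorname{KG}^p(\mathcal{H})$ with colors $1,\ldots,t$, the hypergraph $\operatorname{KG}^p(\mathcal{H})$ contains a complete $p$-uniform $p$-partite hypergraph with parts $U_1,\ldots,U_p$ satisfying the following properties: \begin{itemize} \item It has $\operatorname{cd}^p(\mathcal{H})$ vertices, i.e. $|U_1|+\cdots+|U_p|=\operatorname{cd}^p(\mathcal{H})$. \item The values of $|U_j|$ for $j=1,\ldots,p$ differ by at most one. \item For any $j\in\{1,\ldots,p\}$, the vertices of $U_j$ get pairwise distinct colors under $c$. \end{itemize}
   Context: A hypergraph is a pair $\mathcal{H}=(V(\mathcal{H}),E(\mathcal{H}))$, where $V(\mathcal{H})$ is a finite set (the vertex set) and $E(\mathcal{H})$ is a family of subsets of $V(\mathcal{H})$ (the edge set). It is $q$-uniform if every edge has cardinality $q$. A coloring of $\mathcal{H}$ is a map $c:V(\mathcal{H})\to[t]=\{1,\ldots,t\}$ for some positive integer $t$; it is proper if there is no monochromatic edge, i.e. no edge $e$ with $|c(e)|=1$. The chromatic number $\chi(\mathcal{H})$ is the minimal $t$ for which a proper coloring with colors in $[t]$ exists. In particular, a hypergraph having an edge of cardinality one has no proper coloring, and "$\chi(\mathcal{H})\leq q$" means that a proper coloring with $q$ colors exists. For $X\subseteq V(\mathcal{H})$, the induced subhypergraph $\mathcal{H}[X]$ has vertex set $X$ and edge set $\{e\in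 E(\mathcal{H}):e\subseteq X\}$. For an integer $q\geq 2$, the Kneser hypergraph $\operatorname{KG}^q(\mathcal{H})$ has vertex set $E(\mathcal{H})$, and its edges are the sets $\{e_1,\ldots,e_q\}$ with $e_1,\ldots,e_q\in E(\mathcal{H})$ and $e_i\cap e_j=\emptyset$ for all $i\neq j$. The $q$-colorability defect is $\operatorname{cd}^q(\mathcal{H})=\min\{|Y|:\,Y\subseteq V(\mathcal{H}),\ \chi(\mathcal{H}[V(\mathcal{H})\setminus Y])\leq q\}$. A $q$-uniform $q$-partite hypergraph with parts $U_1,\ldots,U_q$ is a hypergraph whose vertex set is partitioned into $U_1,\ldots,U_q$ (parts may be empty) so that each edge has cardinality $q$ and intersects each $U_i$ in exactly one vertex; it is complete if all possible such edges exist. A hypergraph contains it if the $U_i$ are pairwise disjoint sets of vertices of the hypergraph and every set $\{u_1,\ldots,u_q\}$ with $u_i\in U_i$ for all $i$ is an edge of the hypergraph. *)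

theory Defs
  imports
    "HOL-Computational_Algebra.Primes"
    "HOL-Library.Extended_Nat"
    "HOL-Library.Disjoint_Sets"
begin

record 'a hypergraph =
  verts :: "'a set"
  edges :: "'a set set"

definition hypergraph :: "'a hypergraph \<Rightarrow> bool" where
  "hypergraph H \<longleftrightarrow> finite (verts H) \<and> (\<forall>e\<in>edges H. e \<subseteq> verts H)"

definition proper_coloring :: "'a hypergraph \<Rightarrow> nat \<Rightarrow> ('a \<Rightarrow> nat) \<Rightarrow> bool" where
  "proper_coloring H t c \<longleftrightarrow>
     (\<forall>v\<in>verts H. c v \<in> {1..t}) \<and> (\<forall>e\<in>edges H. card (c ` e) \<noteq> 1)"

text \<open>The value is \<open>\<infinity>\<close> if no proper coloring exists, that is, if some edge is a singleton.\<close>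

definition chromatic_number :: "'a hypergraph \<Rightarrow> enat" where
  "chromatic_number H = Inf {enat t | t. t > 0 \<and> (\<exists>c. proper_coloring H t c)}"

definition induced :: "'a hypergraph \<Rightarrow> 'a set \<Rightarrow> 'a hypergraph" where
  "induced H X = \<lparr>verts = X, edges = {e \<in> edges H. e \<subseteq> X}\<rparr>"

definition kneser :: "nat \<Rightarrow> 'a hypergraph \<Rightarrow> 'a set hypergraph" where
  "kneser q H =
     \<lparr>verts = edges H,
      edges = {e ` {1..q} | e. e \<in> {1..q} \<rightarrow> edges H \<and>
                 (\<forall>i\<in>{1..q}. \<forall>j\<in>{1..q}. i \<noteq> j \<longrightarrow> e i \<inter> e j = {})}\<rparr>"

definition colorability_defect :: "nat \<Rightarrow> 'a hypergraph \<Rightarrow> nat" where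
  "colorability_defect q H =
     Min {card Y | Y. Y \<subseteq> verts H \<and> chromatic_number (induced H (verts H - Y)) \<le> enat q}"

text \<open>The parts are \<open>U 1, \<dots>, U q\<close>; they may be empty. Disjointness of the parts forces every
  edge \<open>u ` {1..q}\<close> below to have exactly \<open>q\<close> elements.\<close>

definition contains_complete_partite :: "'a hypergraph \<Rightarrow> nat \<Rightarrow> (nat \<Rightarrow> 'a set) \<Rightarrow> bool" where
  "contains_complete_partite K q U \<longleftrightarrow>
     (\<forall>i\<in>{1..q}. U i \<subseteq> verts K) \<and>
     disjoint_family_on U {1..q} \<and>
     (\<forall>u. (\<forall>i\<in>{1..q}. u i \<in> U i) \<longrightarrow> u ` {1..q} \<in> edges K)"

end

theory Submission
  imports Defs "HOL-Number_Theory.Cong"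
begin

text \<open>
  Number the vertices \<open>0, \<dots>, n - 1\<close> and let the signs be the elements of \<open>\<int>/p\<close>. Put a sign on some of
  the vertices; such a partial assignment \<open>X\<close> splits these vertices into \<open>p\<close> disjoint classes. For
  each sign \<open>s\<close> collect the colors of the edges lying inside the class of \<open>s\<close>. Edges in different
  classes are disjoint, so if \<open>k s\<close> colors of class \<open>s\<close> are selected, with \<open>\<Sum>s. k s = cd\<close> and the \<open>k s\<close>
  differing by at most one, and one edge is picked for every selected color, the result is the
  required partite subhypergraph. Such numbers \<open>k s\<close> exist as soon as the \<^emph>\<open>balanced size\<close>
  \<open>p * h + b\<close> is at least \<open>cd\<close>, where \<open>h\<close> is the least number of colors in a class and \<open>b\<close> the number
  of classes with more than \<open>h\<close> colors (\<open>balanced_choice\<close>).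

  It remains to find an assignment of large balanced size. Suppose there is none. Label every
  nonempty assignment \<open>X\<close> with a level and a sign. If no class of \<open>X\<close> contains an edge, the level
  is \<open>card X\<close>, and it is at most \<open>n - cd\<close> because the classes of \<open>X\<close> are a proper \<open>p\<close>-coloring of
  what they cover. Otherwise the level is \<open>n - cd\<close> plus the balanced size. So fewer than \<open>n\<close> levels
  occur. The sign is read off, in the first case from \<open>X\<close> itself, in the second case from the set of
  classes with more than \<open>h\<close> colors or, if that set is empty, from the whole table of colors per
  class, in a way that commutes with the cyclic rotation of the signs. Primality of \<open>p\<close> makes this possible (\<open>sign_of_rot\<close>): a set of residues, neither
  empty nor everything, has a size that is invertible modulo \<open>p\<close>. For the table, properness of the
  coloring guarantees that no color occurs in all classes. Enlarging \<open>X\<close> either raises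
  the level or leaves the label unchanged (\<open>label_mono\<close>).

  This contradicts a Tucker-type theorem (\<open>dimension_le\<close>): an equivariant labeling with
  this monotonicity has at least \<open>n\<close> levels. The assignments are the simplices of the \<open>n\<close>-fold join
  of \<open>\<int>/p\<close> with itself, and the labeling induces an equivariant chain map \<open>F\<close> from the chains of
  the \<open>n\<close>-fold join to those of the \<open>m\<close>-fold join, \<open>m\<close> being the number of levels. If \<open>m < n\<close>, the
  \<open>m\<close>-fold join sits inside a cone in the \<open>n\<close>-fold join, so the restriction of \<open>F\<close> to it is
  null-homotopic and its alternating trace vanishes (\<open>alternating_trace_zero\<close>). On the other hand,
  rotation permutes the nonempty simplices freely, so they contribute a multiple of \<open>p\<close> to
  the trace, while the empty simplex contributes \<open>1\<close>.
\<close>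

section \<open>Oriented simplices of iterated joins\<close>

definition shift :: "nat \<Rightarrow> nat \<Rightarrow> nat" where
  "shift p s = (s + 1) mod p"

definition rot :: "nat \<Rightarrow> nat \<times> nat \<Rightarrow> nat \<times> nat" where
  "rot p x = (fst x, shift p (snd x))"

lemma rot_eq: "rot p x = (fst x, (snd x + 1) mod p)"
  by (simp add: rot_def shift_def)

text \<open>A partial assignment of signs below \<open>p\<close> to the numbers below \<open>n\<close>, represented by its graph. The
  assignments, including the empty one, are the simplices of the \<open>n\<close>-fold join of \<open>p\<close> points. In
  the target of a labeling, the first coordinate is a level.\<close>

definition simplices :: "nat \<Rightarrow> nat \<Rightarrow> (nat \<times> nat) set set" where
  "simplices p n = {X. X \<subseteq> {..<n} \<times> {..<p} \<and> inj_on fst X}"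

text \<open>The incidence number of the facet \<open>X - {x}\<close> in \<open>X\<close>, for the orientation that lists the vertices
  by increasing first coordinate.\<close>

definition orient :: "(nat \<times> nat) set \<Rightarrow> nat \<times> nat \<Rightarrow> int" where
  "orient X x = (-1) ^ card {y \<in> X. fst y < fst x}"

lemma finite_simplices: "finite (simplices p n)"
  by (rule finite_subset[of _ "Pow ({..<n} \<times> {..<p})"]) (auto simp: simplices_def)

lemma simplex_finite: "X \<in> simplices p n \<Longrightarrow> finite X"
  unfolding simplices_def by (auto intro: finite_subset[of X "{..<n} \<times> {..<p}"])

lemma simplices_mono: "Y \<in> simplices p n \<Longrightarrow> X \<subseteq> Y \<Longrightarrow> X \<in> simplices p n"
  unfolding simplices_def by (auto intro: inj_on_subset)

lemma empty_simplex [simp]: "{} \<in> simplices p n"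
  by (simp add: simplices_def)

lemma orient_remove_above: "fst x < fst y \<Longrightarrow> orient (X - {y}) x = orient X x"
  unfolding orient_def by (rule arg_cong[where f="\<lambda>A. (-1) ^ card A"]) auto

lemma orient_insert_above: "fst x \<le> fst y \<Longrightarrow> orient (insert y X) x = orient X x"
  unfolding orient_def by (rule arg_cong[where f="\<lambda>A. (-1) ^ card A"]) auto

lemma orient_remove_below:
  assumes "finite X" "x \<in> X" "fst x < fst y"
  shows "orient (X - {x}) y = - orient X y"
proof -
  let ?A = "{z \<in> X. fst z < fst y}"
  have "{z \<in> X - {x}. fst z < fst y} = ?A - {x}" by auto
  moreover have "card ?A = Suc (card (?A - {x}))"
    using assms by (intro card.remove) auto
  ultimately show ?thesis by (simp add: orient_def)
qed

lemma orient_top: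
  assumes "finite X" "\<And>y. y \<in> X \<Longrightarrow> y \<noteq> x \<Longrightarrow> fst y < fst x"
  shows "orient X x = (-1) ^ card (X - {x})"
proof -
  have "{y \<in> X. fst y < fst x} = X - {x}" using assms by auto
  then show ?thesis by (simp add: orient_def)
qed

text \<open>Removing two vertices in either order gives the same face with opposite signs, so the boundary
  of a boundary is zero.\<close>

lemma boundary_boundary:
  assumes "finite X" "inj_on fst X"
  shows "(\<Sum>x\<in>X. orient X x * (\<Sum>y\<in>X - {x}. orient (X - {x}) y * f (X - {x} - {y}))) = (0 :: int)"
proof -
  define g where "g x y = orient X x * (orient (X - {x}) y * f (X - {x} - {y}))" for x y
  let ?P = "SIGMA x:X. X - {x}"
  have anti: "g y x = - g x y" if "x \<in> X" "y \<in> X" "fst x < fst y" for x y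
    using that assms(1) orient_remove_above[of x y X] orient_remove_below[of X x y]
    by (simp add: g_def Diff_insert2[symmetric] insert_commute)
  have anti': "g y x = - g x y" if "x \<in> X" "y \<in> X" "x \<noteq> y" for x y
  proof -
    have "fst x \<noteq> fst y" using that assms(2) by (auto dest: inj_onD)
    then show ?thesis using anti[of x y] anti[of y x] that by linarith
  qed
  have "(\<Sum>(x, y)\<in>?P. g x y) = (\<Sum>(x, y)\<in>?P. g y x)"
    by (rule sum.reindex_bij_witness[of _ prod.swap prod.swap]) auto
  also have "\<dots> = (\<Sum>(x, y)\<in>?P. - g x y)"
    by (intro sum.cong) (auto intro: anti')
  also have "\<dots> = - (\<Sum>(x, y)\<in>?P. g x y)"
    by (simp add: sum_negf case_prod_unfold)
  finally have "(\<Sum>(x, y)\<in>?P. g x y) = 0" by simp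
  then show ?thesis
    using assms(1) by (simp add: g_def sum.Sigma sum_distrib_left)
qed

lemma rot_inj_on: "inj_on (rot p) (UNIV \<times> {..<p})"
proof (rule inj_onI)
  fix x y assume "x \<in> UNIV \<times> {..<p}" "y \<in> UNIV \<times> {..<p}" and eq: "rot p x = rot p y"
  then have "snd x < p" "snd y < p" by auto
  moreover have "[snd x + 1 = snd y + 1] (mod p)" using eq by (simp add: rot_eq cong_def)
  then have "[snd x = snd y] (mod p)" by (metis cong_add_rcancel_nat)
  ultimately have "snd x = snd y" by (simp add: cong_def)
  with eq show "x = y" by (simp add: rot_eq prod_eq_iff)
qed

lemma rot_Pair: "rot p (i, s) = (i, (s + 1) mod p)"
  by (simp add: rot_eq)

lemma fst_rot [simp]: "fst (rot p x) = fst x"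
  by (simp add: rot_eq)

lemma rot_simplex:
  assumes "X \<in> simplices p n"
  shows "rot p ` X \<in> simplices p n"
proof -
  have "rot p x \<in> {..<n} \<times> {..<p}" if "x \<in> X" for x
    using that assms by (cases x) (fastforce simp: simplices_def rot_eq)
  moreover have "inj_on fst (rot p ` X)"
    using assms by (auto simp: simplices_def inj_on_def) 
  ultimately show ?thesis unfolding simplices_def by blast
qed

lemma simplex_rot_inj: "X \<in> simplices p n \<Longrightarrow> inj_on (rot p) X"
  by (rule inj_on_subset[OF rot_inj_on]) (auto simp: simplices_def)

lemma orient_rot:
  assumes "X \<in> simplices p n"
  shows "orient (rot p ` X) (rot p x) = orient X x"
proof -
  have "{y \<in> rot p ` X. fst y < fst (rot p x)} = rot p ` {y \<in> X. fst y < fst x}" by auto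
  moreover have "card \<dots> = card {y \<in> X. fst y < fst x}"
    by (intro card_image inj_on_subset[OF simplex_rot_inj[OF assms]]) auto
  ultimately show ?thesis by (simp add: orient_def)
qed

text \<open>The nonempty simplices are grouped by the sign of their vertex of least first coordinate.
  Rotation maps each group bijectively to the next, so all \<open>p\<close> groups have the same sum.\<close>

lemma invariant_sum_dvd:
  assumes p: "p > 0"
    and inv: "\<And>X. X \<in> simplices p m \<Longrightarrow> f (rot p ` X) = (f X :: int)"
  shows "int p dvd (\<Sum>X\<in>simplices p m - {{}}. f X)"
proof -
  define first where "first X = snd (SOME x. x \<in> X \<and> (\<forall>y\<in>X. fst x \<le> fst y))" for X :: "(nat \<times> nat) set"
  define C where "C j = {X \<in> simplices p m - {{}}. first X = j}" for j
  have firstI: "first X = snd x" if X: "X \<in> simplices p m" and x: "x \<in> X" "\<forall>y\<in>X. fst x \<le> fst y" for X x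
  proof -
    have "(SOME x. x \<in> X \<and> (\<forall>y\<in>X. fst x \<le> fst y)) = x"
    proof (rule some_equality)
      fix z assume "z \<in> X \<and> (\<forall>y\<in>X. fst z \<le> fst y)"
      then show "z = x" using X x by (auto simp: simplices_def intro!: inj_onD[of fst X] antisym)
    qed (use x in auto)
    then show ?thesis by (simp add: first_def)
  qed
  have ex_first: "\<exists>x\<in>X. \<forall>y\<in>X. fst x \<le> fst y" if "X \<noteq> {}" "X \<in> simplices p m" for X
    using that arg_min_if_finite[OF simplex_finite, of X p m fst]
    by (metis leI)
  have first_lt: "first X < p" if "X \<in> simplices p m - {{}}" for X
    using ex_first[of X] firstI[of X] that by (fastforce simp: simplices_def)
  have first_rot: "first (rot p ` X) = (first X + 1) mod p" if "X \<in> simplices p m - {{}}" for X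
  proof -
    have X: "X \<in> simplices p m" "X \<noteq> {}" using that by auto
    obtain x where x: "x \<in> X" "\<forall>y\<in>X. fst x \<le> fst y" using ex_first[OF X(2,1)] by blast
    have "first X = snd x" by (rule firstI[OF X(1) x])
    moreover have "first (rot p ` X) = snd (rot p x)"
      by (rule firstI[OF rot_simplex[OF X(1)]]) (use x in auto)
    ultimately show ?thesis by (simp add: rot_eq)
  qed
  have step: "sum f (C (Suc j)) = sum f (C j)" if j: "Suc j < p" for j
  proof -
    have inj: "inj_on ((`) (rot p)) (simplices p m)"
    proof (rule inj_onI)
      fix X Y assume "X \<in> simplices p m" "Y \<in> simplices p m" "rot p ` X = rot p ` Y"
      then show "X = Y"
        using inj_on_image_eq_iff[OF rot_inj_on[of p], of X Y] by (auto simp: simplices_def)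
    qed
    have surj: "(`) (rot p) ` simplices p m = simplices p m"
      by (rule endo_inj_surj) (auto simp: finite_simplices rot_simplex inj)
    have "(`) (rot p) ` C j = C (Suc j)"
    proof
      show "(`) (rot p) ` C j \<subseteq> C (Suc j)"
      proof
        fix Y assume "Y \<in> (`) (rot p) ` C j"
        then obtain X where "X \<in> simplices p m - {{}}" "first X = j" "Y = rot p ` X"
          by (auto simp: C_def)
        then show "Y \<in> C (Suc j)" using j first_rot[of X] rot_simplex[of X] by (auto simp: C_def)
      qed
      show "C (Suc j) \<subseteq> (`) (rot p) ` C j"
      proof
        fix Y assume Y: "Y \<in> C (Suc j)"
        then have "Y \<in> (`) (rot p) ` simplices p m" by (simp only: surj) (simp add: C_def)
        then obtain X where X: "X \<in> simplices p m" "Y = rot p ` X" by blast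
        then have X': "X \<in> simplices p m - {{}}" using Y by (auto simp: C_def)
        have "Suc j = Suc (first X) mod p" using first_rot[OF X'] Y X by (simp add: C_def)
        then have "first X = j" using first_lt[OF X'] by (cases "Suc (first X) = p") auto
        then show "Y \<in> (`) (rot p) ` C j" using X X' by (auto simp: C_def)
      qed
    qed
    then have "sum f (C (Suc j)) = sum (f \<circ> (`) (rot p)) (C j)"
      using sum.reindex[OF inj_on_subset[OF inj], of "C j" f] by (auto simp: C_def)
    also have "\<dots> = sum f (C j)" by (intro sum.cong) (auto simp: C_def inv)
    finally show ?thesis .
  qed
  have all: "sum f (C j) = sum f (C 0)" if "j < p" for j
    using that by (induction j) (auto simp: step)
  have "first ` (simplices p m - {{}}) \<subseteq> {..<p}" using first_lt by blast
  then have "(\<Sum>X\<in>simplices p m - {{}}. f X) = (\<Sum>j<p. sum f (C j))"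
    unfolding C_def by (intro sum.group[symmetric]) (simp_all add: finite_simplices)
  also have "\<dots> = (\<Sum>j<p. sum f (C 0))" by (intro sum.cong refl all) simp
  also have "\<dots> = int p * sum f (C 0)" by simp
  finally show ?thesis by simp
qed

section \<open>The chain map induced by an equivariant labeling\<close>

text \<open>The coefficient of the simplex \<open>T\<close> in \<open>F X\<close>, where \<open>F\<close> is the chain map induced by the labeling:
  \<open>F {} = {}\<close> and \<open>F X\<close> is, up to sign, the join of \<open>F (\<partial>X)\<close> with the vertex \<open>label X\<close>, where simplices
  that already contain this vertex contribute zero. Thus \<open>F X\<close> is a signed sum, over the full flags of
  faces of \<open>X\<close>, of the sets of labels along the flag, where flags with a repeated
  label are left out. The vertex \<open>label X\<close> is joined at the end because it has the largest level, which
  explains the power of \<open>-1\<close>.\<close>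

function coeff ::
    "((nat \<times> nat) set \<Rightarrow> nat \<times> nat) \<Rightarrow> (nat \<times> nat) set \<Rightarrow> (nat \<times> nat) set \<Rightarrow> int" where
  "coeff label X T =
     (if X = {} \<or> infinite X then of_bool (T = {})
      else if label X \<in> T
        then (-1) ^ (card X - 1) * (\<Sum>x\<in>X. orient X x * coeff label (X - {x}) (T - {label X}))
      else 0)"
  by pat_completeness auto
termination
  by (relation "measure (\<lambda>(_, X, _). card X)") (auto simp: card_gt_0_iff)

declare coeff.simps [simp del]

lemma coeff_empty [simp]: "coeff label {} T = of_bool (T = {})"
  by (simp add: coeff.simps)

text \<open>\<open>label_mono\<close> says that the labeling is an order-preserving map from the face poset of the
  \<open>n\<close>-fold join to \<open>{..<m} \<times> {..<p}\<close>, where two labels are comparable if they are equal or differ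
  in level.\<close>

locale equivariant_labeling =
  fixes p n m :: nat and label :: "(nat \<times> nat) set \<Rightarrow> nat \<times> nat"
  assumes p_ge_2: "p \<ge> 2"
    and label_in: "X \<in> simplices p n \<Longrightarrow> X \<noteq> {} \<Longrightarrow> label X \<in> {..<m} \<times> {..<p}"
    and label_rot: "X \<in> simplices p n \<Longrightarrow> X \<noteq> {} \<Longrightarrow> label (rot p ` X) = rot p (label X)"
    and label_mono: "Y \<in> simplices p n \<Longrightarrow> X \<noteq> {} \<Longrightarrow> X \<subseteq> Y \<Longrightarrow>
                     fst (label X) < fst (label Y) \<or> label X = label Y"
begin

lemma coeff_rec:
  assumes "X \<in> simplices p n" "X \<noteq> {}"
  shows "coeff label X T = (if label X \<in> T
     then (-1) ^ (card X - 1) * (\<Sum>x\<in>X. orient X x * coeff label (X - {x}) (T - {label X})) else 0)"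
  using assms simplex_finite[of X p n] by (simp add: coeff.simps[of label X])

text \<open>By monotonicity, the labels that occur in the image of a proper face of \<open>X\<close> are \<open>label X\<close> itself
  or have a smaller level. Hence joining with \<open>label X\<close> never puts two vertices on the same level.\<close>

lemma coeff_support:
  assumes "X \<in> simplices p n" "coeff label X T \<noteq> 0"
  shows "T \<in> simplices p m \<and> card T = card X \<and> T \<subseteq> label ` (Pow X - {{}})"
  using assms
proof (induction "card X" arbitrary: X T)
  case 0
  then have "X = {}" using simplex_finite by auto
  with 0 show ?case by (auto split: if_splits)
next
  case (Suc k)
  then have X: "X \<noteq> {}" "finite X" using simplex_finite by auto
  let ?l = "label X" and ?T = "T - {label X}"
  have l: "?l \<in> T" and "(\<Sum>x\<in>X. orient X x * coeff label (X - {x}) ?T) \<noteq> 0"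
    using Suc.prems X by (auto simp: coeff_rec split: if_splits)
  then obtain x where x: "x \<in> X" "coeff label (X - {x}) ?T \<noteq> 0"
    by (metis (mono_tags, lifting) mult_zero_right sum.neutral)
  have Xx: "X - {x} \<in> simplices p n" by (rule simplices_mono[OF Suc.prems(1)]) auto
  have IH: "?T \<in> simplices p m" "card ?T = card (X - {x})" "?T \<subseteq> label ` (Pow (X - {x}) - {{}})"
    using Suc.hyps(1)[OF _ Xx x(2)] Suc.hyps(2) x(1) X by auto
  have below: "fst y < fst ?l" if "y \<in> ?T" for y
  proof -
    from subsetD[OF IH(3) that] obtain Y where "Y \<subseteq> X" "Y \<noteq> {}" "y = label Y" by auto
    then show ?thesis using label_mono[OF Suc.prems(1), of Y] that by auto
  qed
  have T: "T = insert ?l ?T" using l by auto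
  have "inj_on fst (insert ?l ?T)"
    using IH(1) below by (fastforce simp: simplices_def)
  then have "T \<in> simplices p m"
    using IH(1) label_in[OF Suc.prems(1) X(1)] T by (auto simp: simplices_def)
  moreover have "card T = card X"
    using IH(2) card.remove[OF X(2) x(1)] card_insert_disjoint[OF simplex_finite[OF IH(1)], of ?l] T
    by simp
  moreover have "insert ?l ?T \<subseteq> label ` (Pow X - {{}})"
    using X(1) by (intro insert_subsetI image_eqI[of _ _ X] subset_trans[OF IH(3)] image_mono) auto
  ultimately show ?case using T by simp
qed

lemma boundary_support:
  assumes X: "X \<in> simplices p n" "X \<noteq> {}"
    and nz: "(\<Sum>x\<in>X. orient X x * coeff label (X - {x}) T) \<noteq> 0"
  shows "finite T" "card T = card X - 1" "\<And>y. y \<in> T \<Longrightarrow> y \<noteq> label X \<Longrightarrow> fst y < fst (label X)"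
proof -
  obtain x where x: "x \<in> X" "coeff label (X - {x}) T \<noteq> 0"
    using nz by (metis (mono_tags, lifting) mult_zero_right sum.neutral)
  have S: "T \<in> simplices p m" "card T = card (X - {x})" "T \<subseteq> label ` (Pow (X - {x}) - {{}})"
    using coeff_support[OF simplices_mono[OF X(1)] x(2)] by auto
  show "finite T" by (rule simplex_finite[OF S(1)])
  show "card T = card X - 1" using S(2) x(1) by simp
  show "fst y < fst (label X)" if "y \<in> T" "y \<noteq> label X" for y
  proof -
    from subsetD[OF S(3) that(1)] obtain Y where "Y \<subseteq> X" "Y \<noteq> {}" "y = label Y" by auto
    then show ?thesis using label_mono[OF X(1), of Y] that by auto
  qed
qed

text \<open>The identity \<open>F (\<partial>X) = \<partial>(F X)\<close>, read at the simplex \<open>T\<close>. The boundary of the cone \<open>F (\<partial>X) * label X\<close>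
  consists of its base \<open>F (\<partial>X)\<close> and of the cone over \<open>\<partial>(F (\<partial>X))\<close>. By induction the latter equals
  \<open>F (\<partial>(\<partial>X)) = 0\<close>.\<close>

lemma coeff_chain_map:
  assumes "X \<in> simplices p n"
  shows "(\<Sum>x\<in>X. orient X x * coeff label (X - {x}) T) =
    (\<Sum>y\<in>{..<m} \<times> {..<p} - T. orient (insert y T) y * coeff label X (insert y T))"
  using assms
proof (induction "card X" arbitrary: X T)
  case 0
  then have "X = {}" using simplex_finite by auto
  then show ?case by simp
next
  case (Suc k)
  then have X: "X \<noteq> {}" "finite X" using simplex_finite by auto
  let ?V = "{..<m} \<times> {..<p}"
  have finV: "finite ?V" by simp
  define l where "l = label X"
  define B where "B T = (\<Sum>x\<in>X. orient X x * coeff label (X - {x}) T)" for T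
  have lV: "l \<in> ?V" using label_in Suc.prems X by (simp add: l_def)
  have coefX: "coeff label X T = (if l \<in> T then (-1) ^ k * B (T - {l}) else 0)" for T
    using coeff_rec[OF Suc.prems X(1)] Suc.hyps(2) by (simp add: l_def B_def flip: Suc.hyps(2))
  have Bsupp: "finite T" "card T = k" "\<And>y. y \<in> T \<Longrightarrow> y \<noteq> l \<Longrightarrow> fst y < fst l"
    if "B T \<noteq> 0" for T
    using boundary_support[OF Suc.prems X(1), of T] that Suc.hyps(2)
    by (auto simp: B_def l_def)
  have "B T = (\<Sum>y\<in>?V - T. orient (insert y T) y * coeff label X (insert y T))"
  \<comment> \<open>If \<open>T\<close> misses \<open>l\<close>, only the base of the cone contributes. Otherwise the contributions come
      from the cone over the boundary of those simplices of \<open>F (\<partial>X)\<close> that miss \<open>l\<close>.\<close>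
  proof (cases "l \<in> T")
    case False
    have "(\<Sum>y\<in>?V - T. orient (insert y T) y * coeff label X (insert y T))
        = (\<Sum>y\<in>{l}. orient (insert y T) y * coeff label X (insert y T))"
      by (rule sum.mono_neutral_right) (use lV False in \<open>auto simp: coefX\<close>)
    also have "\<dots> = orient (insert l T) l * ((-1) ^ k * B T)"
      using False by (simp add: coefX)
    also have "\<dots> = B T"
    proof (cases "B T = 0")
      case nz: False
      have "orient (insert l T) l = (-1) ^ k"
        using orient_top[of "insert l T" l] Bsupp[OF nz] False by auto
      then show ?thesis by (simp flip: power_add mult.assoc mult_2)
    qed simp
    finally show ?thesis by simp
  next
    case True
    define R where "R = T - {l}"
    have T: "T = insert l R" "l \<notin> R" using True by (auto simp: R_def)
    have VR: "?V - R = insert l (?V - T)" "l \<notin> ?V - T" using lV T by auto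
    have IH: "(\<Sum>y\<in>?V - R. orient (insert y R) y * coeff label (X - {x}) (insert y R))
       = (\<Sum>y\<in>X - {x}. orient (X - {x}) y * coeff label (X - {x} - {y}) R)" if "x \<in> X" for x
      using Suc.hyps(1)[of "X - {x}" R] simplices_mono[OF Suc.prems, of "X - {x}"]
        that Suc.hyps(2) X(2) by auto
    \<comment> \<open>This is \<open>\<partial>(F (\<partial>X)) = F (\<partial>(\<partial>X)) = 0\<close> at \<open>R\<close>; its term at \<open>y = l\<close> accounts for \<open>B T\<close>.\<close>
    have "(\<Sum>y\<in>?V - R. orient (insert y R) y * B (insert y R))
        = (\<Sum>x\<in>X. orient X x * (\<Sum>y\<in>?V - R. orient (insert y R) y * coeff label (X - {x}) (insert y R)))"
      unfolding B_def sum_distrib_left by (subst sum.swap) (simp add: mult_ac)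
    also have "\<dots> = 0"
      using boundary_boundary[OF X(2), of "\<lambda>Z. coeff label Z R"] Suc.prems
      by (simp add: IH simplices_def)
    finally have zero: "orient (insert l R) l * B (insert l R)
        + (\<Sum>y\<in>?V - T. orient (insert y R) y * B (insert y R)) = 0"
      using VR finV by (simp add: sum.insert[OF _ VR(2)])
    have "(\<Sum>y\<in>?V - T. orient (insert y T) y * coeff label X (insert y T))
        = (\<Sum>y\<in>?V - T. (-1) ^ k * (orient (insert y R) y * B (insert y R)))"
    proof (rule sum.cong[OF refl])
      fix y assume y: "y \<in> ?V - T"
      then have yl: "y \<noteq> l" using True by auto
      have eq: "insert y T - {l} = insert y R" using T yl by auto
      show "orient (insert y T) y * coeff label X (insert y T)
          = (-1) ^ k * (orient (insert y R) y * B (insert y R))"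
      proof (cases "B (insert y R) = 0")
        case False
        then have "fst y < fst l" using Bsupp(3)[of "insert y R" y] yl by simp
        then have "orient (insert y T) y = orient (insert y R) y"
          using orient_insert_above[of y l "insert y R"] by (simp add: T insert_commute)
        then show ?thesis using True by (simp add: coefX eq)
      qed (use True in \<open>simp add: coefX eq\<close>)
    qed
    also have "\<dots> = (-1) ^ k * - (orient T l * B T)"
    proof -
      have "(\<Sum>y\<in>?V - T. orient (insert y R) y * B (insert y R)) = - (orient T l * B T)"
        using zero by (simp flip: T(1))
      then show ?thesis by (simp flip: sum_distrib_left)
    qed
    also have "\<dots> = B T"
    proof (cases "B T = 0")
      case nz: False
      have "orient T l = (-1) ^ card R"
        using orient_top[of T l] Bsupp[OF nz] by (simp add: R_def)
      moreover have "k = Suc (card R)"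
        using Bsupp(1,2)[OF nz] T by auto
      ultimately show ?thesis by (simp flip: power_add mult.assoc mult_2)
    qed simp
    finally show ?thesis by simp
  qed
  then show ?case by (simp add: B_def)
qed

lemma coeff_rot:
  assumes "X \<in> simplices p n" "T \<in> simplices p m"
  shows "coeff label (rot p ` X) (rot p ` T) = coeff label X T"
  using assms
proof (induction "card X" arbitrary: X T)
  case 0
  then have "X = {}" using simplex_finite by auto
  then show ?case by simp
next
  case (Suc k)
  then have X: "X \<noteq> {}" using simplex_finite by auto
  note lX = label_in[OF Suc.prems(1) X]
  have injX: "inj_on (rot p) X" by (rule simplex_rot_inj[OF Suc.prems(1)])
  have injT: "inj_on (rot p) (insert (label X) T)"
    by (rule inj_on_subset[OF rot_inj_on[of p]]) (use lX Suc.prems(2) in \<open>auto simp: simplices_def\<close>)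
  have mem: "rot p (label X) \<in> rot p ` T \<longleftrightarrow> label X \<in> T"
    using injT by (auto simp: inj_on_def)
  have rem: "rot p ` T - {rot p (label X)} = rot p ` (T - {label X})"
    using injT by (auto simp: inj_on_def)
  have remX: "rot p ` X - {rot p x} = rot p ` (X - {x})" if "x \<in> X" for x
    using injX that by (auto simp: inj_on_def)
  have "(\<Sum>x\<in>rot p ` X. orient (rot p ` X) x * coeff label (rot p ` X - {x}) (rot p ` (T - {label X})))
     = (\<Sum>x\<in>X. orient X x * coeff label (X - {x}) (T - {label X}))"
    unfolding sum.reindex[OF injX] o_def
  proof (rule sum.cong[OF refl])
    fix x assume x: "x \<in> X"
    have "k = card (X - {x})" using Suc.hyps(2) x simplex_finite[OF Suc.prems(1)] by simp
    then have "coeff label (rot p ` (X - {x})) (rot p ` (T - {label X})) = coeff label (X - {x}) (T - {label X})"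
      by (rule Suc.hyps(1))
         (use simplices_mono[OF Suc.prems(1)] simplices_mono[OF Suc.prems(2)] in auto)
    then show "orient (rot p ` X) (rot p x) * coeff label (rot p ` X - {rot p x}) (rot p ` (T - {label X}))
      = orient X x * coeff label (X - {x}) (T - {label X})"
      using orient_rot[OF Suc.prems(1)] x by (simp add: remX)
  qed
  then show ?case
    using coeff_rec[OF Suc.prems(1) X] coeff_rec[OF rot_simplex[OF Suc.prems(1)], of "rot p ` T"] X
      label_rot[OF Suc.prems(1) X] card_image[OF injX]
    by (simp add: mem rem)
qed

text \<open>Let \<open>v\<close> be a vertex on coordinate \<open>m\<close>, and let \<open>K S = F (S * v)\<close>. Since \<open>v\<close> is the last vertex of
  \<open>S * v\<close>, the chain map property gives
  \<open>\<partial>(K S) = F (\<partial>(S * v)) = K (\<partial>S) + (-1) ^ card S * F S\<close>. So up to the sign \<open>F\<close> is the commutator of \<open>\<partial>\<close> and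
  \<open>K\<close>, and commutators have trace zero.\<close>

lemma alternating_trace_zero:
  assumes "m < n"
  shows "(\<Sum>S\<in>simplices p m. (-1) ^ card S * coeff label S S) = 0"
proof -
  let ?V = "{..<m} \<times> {..<p}" and ?S = "simplices p m" and ?v = "(m, 0::nat)"
  define K where "K S T = coeff label (insert ?v S) T" for S T
  have cone: "insert ?v S \<in> simplices p n" if "S \<in> ?S" for S
    using that assms p_ge_2 by (fastforce simp: simplices_def)
  have S: "finite S" "\<And>y. y \<in> S \<Longrightarrow> fst y < m" if "S \<in> ?S" for S
    using that simplex_finite by (auto simp: simplices_def)
  have id: "(-1) ^ card S * coeff label S S
     = (\<Sum>y\<in>?V - S. orient (insert y S) y * K S (insert y S))
       - (\<Sum>x\<in>S. orient S x * K (S - {x}) S)" if SS: "S \<in> ?S" for S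
  proof -
    have v: "?v \<notin> S" using S(2)[OF SS] by fastforce
    have "(\<Sum>x\<in>insert ?v S. orient (insert ?v S) x * coeff label (insert ?v S - {x}) S)
       = orient (insert ?v S) ?v * coeff label S S + (\<Sum>x\<in>S. orient S x * K (S - {x}) S)"
    proof -
      have "orient (insert ?v S) x * coeff label (insert ?v S - {x}) S = orient S x * K (S - {x}) S"
        if "x \<in> S" for x
      proof -
        have "insert ?v S - {x} = insert ?v (S - {x})" using that v by auto
        then show ?thesis
          using orient_insert_above[of x ?v S] S(2)[OF SS that] by (simp add: K_def)
      qed
      then show ?thesis using v S(1)[OF SS] by simp
    qed
    moreover have "orient (insert ?v S) ?v = (-1) ^ card S"
      using orient_top[of "insert ?v S" ?v] S[OF SS] v by auto
    ultimately show ?thesis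
      using coeff_chain_map[OF cone[OF SS], of S] by (simp add: K_def)
  qed
  have "(\<Sum>S\<in>?S. \<Sum>y\<in>?V - S. orient (insert y S) y * K S (insert y S))
      = (\<Sum>S\<in>?S. \<Sum>x\<in>S. orient S x * K (S - {x}) S)"
  proof -
    \<comment> \<open>Both sides run over the incident pairs of a simplex and its facet.\<close>
    have supp: "insert y S \<in> ?S" if "S \<in> ?S" "orient (insert y S) y * K S (insert y S) \<noteq> 0" for y S
      using coeff_support[OF cone[OF that(1)], of "insert y S"] that(2) by (auto simp: K_def)
    have "(\<Sum>S\<in>?S. \<Sum>y\<in>?V - S. orient (insert y S) y * K S (insert y S))
        = (\<Sum>(S, y)\<in>(SIGMA S:?S. ?V - S). orient (insert y S) y * K S (insert y S))"
      by (rule sum.Sigma) (auto simp: finite_simplices)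
    also have "\<dots> = (\<Sum>(S, y)\<in>{(S, y). S \<in> ?S \<and> y \<in> ?V - S \<and> insert y S \<in> ?S}.
        orient (insert y S) y * K S (insert y S))"
      by (rule sum.mono_neutral_right) (use supp in \<open>auto simp: finite_simplices\<close>)
    also have "\<dots> = (\<Sum>(S, x)\<in>(SIGMA S:?S. S). orient S x * K (S - {x}) S)"
      by (rule sum.reindex_bij_witness[of _ "\<lambda>(S, x). (S - {x}, x)" "\<lambda>(S, x). (insert x S, x)"])
         (auto simp: insert_absorb simplices_mono, auto simp: simplices_def)
    also have "\<dots> = (\<Sum>S\<in>?S. \<Sum>x\<in>S. orient S x * K (S - {x}) S)"
      by (rule sum.Sigma[symmetric]) (auto simp: finite_simplices simplex_finite)
    finally show ?thesis .
  qed
  then show ?thesis by (simp add: id sum_subtractf)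
qed

text \<open>The diagonal coefficients are invariant under rotation, so the nonempty simplices contribute a
  multiple of \<open>p\<close> to the vanishing trace, and the empty simplex contributes \<open>1\<close>.\<close>

theorem dimension_le: "n \<le> m"
proof (rule ccontr)
  assume "\<not> n \<le> m"
  then have mn: "m < n" by simp
  have sub: "simplices p m \<subseteq> simplices p n" using mn by (auto simp: simplices_def)
  let ?f = "\<lambda>S. (-1) ^ card S * coeff label S S"
  have "int p dvd (\<Sum>S\<in>simplices p m - {{}}. ?f S)"
  proof (rule invariant_sum_dvd)
    fix X assume X: "X \<in> simplices p m"
    then show "?f (rot p ` X) = ?f X"
      using coeff_rot[of X X] sub card_image[OF simplex_rot_inj[OF X]] by auto
  qed (use p_ge_2 in simp)
  moreover have "(\<Sum>S\<in>simplices p m - {{}}. ?f S) = -1"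
    using alternating_trace_zero[OF mn] sum.remove[OF finite_simplices, of "{}" p m ?f] by simp
  ultimately show False using p_ge_2 by simp
qed

end

section \<open>Balanced selections\<close>

definition min_size :: "nat \<Rightarrow> (nat \<Rightarrow> nat) \<Rightarrow> nat" where
  "min_size p N = Min (N ` {..<p})"

definition above_min :: "nat \<Rightarrow> (nat \<Rightarrow> nat) \<Rightarrow> nat set" where
  "above_min p N = {s. s < p \<and> min_size p N < N s}"

text \<open>The largest total of numbers \<open>k s \<le> N s\<close>, \<open>s < p\<close>, that pairwise differ by at most one: each \<open>k s\<close> may
  be the minimum of \<open>N\<close>, plus one where \<open>N\<close> allows it.\<close>

definition balanced_size :: "nat \<Rightarrow> (nat \<Rightarrow> nat) \<Rightarrow> nat" where
  "balanced_size p N = p * min_size p N + card (above_min p N)"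

lemma min_size_le: "s < p \<Longrightarrow> min_size p N \<le> N s"
  by (simp add: min_size_def)

lemma min_size_attained:
  assumes "p > 0"
  shows "\<exists>s<p. N s = min_size p N"
proof -
  have "N ` {..<p} \<noteq> {}" using assms by auto
  then have "min_size p N \<in> N ` {..<p}" unfolding min_size_def by (intro Min_in) auto
  then show ?thesis by auto
qed

lemma above_min_proper:
  assumes "p > 0"
  shows "above_min p N \<subset> {..<p}"
proof -
  obtain s where "s < p" "N s = min_size p N" using min_size_attained[OF assms] by blast
  then have "s \<in> {..<p} - above_min p N" by (simp add: above_min_def)
  then show ?thesis by (auto simp: above_min_def)
qed

lemma card_above_min_less: "p > 0 \<Longrightarrow> card (above_min p N) < p"
  using psubset_card_mono[OF _ above_min_proper, of p N] by simp

lemma balanced_size_pos: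
  assumes "s < p" "N s > 0"
  shows "balanced_size p N > 0"
proof (cases "min_size p N = 0")
  case True
  then have "s \<in> above_min p N" using assms by (simp add: above_min_def)
  moreover have "finite (above_min p N)" by (simp add: above_min_def)
  ultimately show ?thesis by (auto simp: balanced_size_def card_gt_0_iff)
qed (use assms in \<open>simp add: balanced_size_def\<close>)

text \<open>The remainder \<open>card (above_min p N)\<close> is less than \<open>p\<close>, so a larger minimum outweighs it. With
  equal minima, the set \<open>above_min\<close> can only grow.\<close>

lemma balanced_size_mono:
  assumes "p > 0" and le: "\<And>s. s < p \<Longrightarrow> N s \<le> N' s"
  shows "balanced_size p N < balanced_size p N' \<or> min_size p N = min_size p N' \<and> above_min p N = above_min p N'"
proof -
  have "min_size p N \<le> min_size p N'"
    using min_size_attained[OF assms(1), of N'] min_size_le[of _ p N] le by (metis order_trans)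
  then consider "min_size p N < min_size p N'" | "min_size p N = min_size p N'" by linarith
  then show ?thesis
  proof cases
    case 1
    have "balanced_size p N < p * Suc (min_size p N)" using card_above_min_less[OF assms(1), of N] by (simp add: balanced_size_def)
    also have "\<dots> \<le> p * min_size p N'" using 1 by (intro mult_left_mono) auto
    also have "\<dots> \<le> balanced_size p N'" by (simp add: balanced_size_def)
    finally show ?thesis ..
  next
    case 2
    then have sub: "above_min p N \<subseteq> above_min p N'" using le by (fastforce simp: above_min_def)
    have "finite (above_min p N')" by (simp add: above_min_def)
    then show ?thesis
      using 2 sub psubset_card_mono[of "above_min p N'" "above_min p N"] by (auto simp: balanced_size_def)
  qed
qed

lemma balanced_choice:
  assumes p: "p > 0" and d: "d \<le> balanced_size p N"
  shows "\<exists>k. (\<forall>s<p. k s \<le> N s) \<and> (\<Sum>s<p. k s) = d \<and> (\<forall>i<p. \<forall>j<p. k i \<le> k j + 1)"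
proof -
  \<comment> \<open>Give \<open>d div p\<close> to everyone and one more to \<open>d mod p\<close> of those who can take it.\<close>
  define q where "q = d div p"
  define B where "B = {s. s < p \<and> q < N s}"
  have finB: "finite B" by (simp add: B_def)
  have dq: "d = p * q + d mod p" by (simp add: q_def)
  have "p * q < p * Suc (min_size p N)"
    using d dq card_above_min_less[OF p, of N] by (simp add: balanced_size_def)
  then have ql: "q \<le> min_size p N" by (simp only: mult_less_cancel1) simp
  have "d mod p \<le> card B"
  proof (cases "q = min_size p N")
    case True
    then show ?thesis using d dq by (simp add: balanced_size_def B_def above_min_def)
  next
    case False
    then have "B = {..<p}" using ql min_size_le[of _ p N] by (fastforce simp: B_def)
    then show ?thesis using p by (simp add: less_imp_le)
  qed
  then obtain R where R: "R \<subseteq> B" "card R = d mod p"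
    using obtain_subset_with_card_n by metis
  define k where "k s = q + of_bool (s \<in> R)" for s
  have "k s \<le> N s" if "s < p" for s
    using R(1) ql min_size_le[OF that, of N] by (auto simp: k_def B_def)
  moreover have "(\<Sum>s<p. k s) = d"
  proof -
    have "{..<p} \<inter> R = R" using R(1) by (auto simp: B_def)
    then have "(\<Sum>s<p. of_bool (s \<in> R)) = card R" by (simp add: of_bool_def sum.If_cases)
    then show ?thesis using dq R(2) by (simp add: k_def sum.distrib)
  qed
  ultimately show ?thesis by (intro exI[of _ k]) (auto simp: k_def)
qed

lemma shift_inj: "inj_on (shift p) {..<p}"
proof (rule inj_onI)
  fix s s' assume "s \<in> {..<p}" "s' \<in> {..<p}" "shift p s = shift p s'"
  then show "s = s'"
    using inj_onD[OF rot_inj_on[of p], of "(0, s)" "(0, s')"] by (auto simp: rot_eq shift_def)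
qed

lemma shift_image: "shift p ` {..<p} = {..<p}"
  by (rule endo_inj_surj) (auto simp: shift_inj, auto simp: shift_def)

lemma balanced_size_shift:
  assumes "\<And>s. s < p \<Longrightarrow> N' (shift p s) = N s"
  shows "min_size p N' = min_size p N" "above_min p N' = shift p ` above_min p N" "balanced_size p N' = balanced_size p N"
proof -
  have "N' ` {..<p} = N' ` shift p ` {..<p}" by (simp add: shift_image)
  also have "\<dots> = N ` {..<p}" using assms by (force simp: image_image)
  finally show min_size: "min_size p N' = min_size p N" by (simp add: min_size_def)
  show above_min: "above_min p N' = shift p ` above_min p N"
  proof -
    have "above_min p N' = {s \<in> shift p ` {..<p}. min_size p N < N' s}"
      by (auto simp: above_min_def min_size shift_image)
    also have "\<dots> = shift p ` above_min p N" using assms by (auto simp: above_min_def)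
    finally show ?thesis .
  qed
  have "inj_on (shift p) (above_min p N)" by (rule inj_on_subset[OF shift_inj]) (auto simp: above_min_def)
  then show "balanced_size p N' = balanced_size p N" by (simp add: balanced_size_def min_size above_min card_image)
qed

section \<open>An equivariant choice of sign\<close>

definition mixed_column :: "nat \<Rightarrow> (nat \<times> nat) set \<Rightarrow> nat \<Rightarrow> bool" where
  "mixed_column p A j \<longleftrightarrow> A `` {j} \<noteq> {} \<and> A `` {j} \<noteq> {..<p}"

text \<open>Let \<open>B\<close> be the first column of \<open>A\<close> that is neither empty nor full. Rotation adds \<open>card B\<close> to the sum
  of \<open>B\<close> modulo \<open>p\<close>. Dividing the sum by \<open>card B\<close> modulo \<open>p\<close>, that is, taking the mean of \<open>B\<close>, gives a
  sign that rotation increases by one.\<close>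

definition sign_of :: "nat \<Rightarrow> (nat \<times> nat) set \<Rightarrow> nat" where
  "sign_of p A = (let B = A `` {LEAST j. mixed_column p A j}
             in (SOME u. [u * card B = 1] (mod p)) * \<Sum>B mod p)"

lemma sign_of_less: "p > 0 \<Longrightarrow> sign_of p A < p"
  by (simp add: sign_of_def Let_def)

lemma sign_of_rot:
  assumes p: "prime p" and A: "A \<subseteq> UNIV \<times> {..<p}" and ex: "mixed_column p A j"
  shows "sign_of p (rot p ` A) = (sign_of p A + 1) mod p"
proof -
  have col: "(rot p ` A) `` {i} = shift p ` (A `` {i})" for i
    by (force simp: rot_eq shift_def)
  have sub: "A `` {i} \<subseteq> {..<p}" for i using A by auto
  have "shift p ` (A `` {i}) = {..<p} \<longleftrightarrow> A `` {i} = {..<p}" for i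
    using inj_on_image_eq_iff[OF shift_inj sub, of "{..<p}" i] by (simp add: shift_image)
  then have pc: "mixed_column p (rot p ` A) = mixed_column p A"
    by (simp add: fun_eq_iff mixed_column_def col)
  define B where "B = A `` {LEAST j. mixed_column p A j}"
  define u where "u = (SOME u. [u * card B = 1] (mod p))"
  have "mixed_column p A (LEAST j. mixed_column p A j)" using ex by (rule LeastI)
  then have B: "B \<noteq> {}" "B \<subset> {..<p}" using sub by (auto simp: mixed_column_def B_def)
  have finB: "finite B" using B(2) finite_subset by blast
  have "0 < card B" "card B < p"
    using B finB psubset_card_mono[of "{..<p}" B] by (auto simp: card_gt_0_iff)
  then have "\<not> p dvd card B" by (auto dest: dvd_imp_le)
  then have "coprime (card B) p" using p by (simp add: prime_imp_coprime coprime_commute)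
  then have "\<exists>u. [u * card B = 1] (mod p)"
    using cong_solve_coprime_nat[of "card B" p] by (auto simp: mult.commute)
  then have u: "[u * card B = 1] (mod p)" unfolding u_def by (rule someI_ex)
  have inj: "inj_on (shift p) B" by (rule inj_on_subset[OF shift_inj]) (use B in auto)
  have "[\<Sum>(shift p ` B) = (\<Sum>s\<in>B. s + 1)] (mod p)"
    unfolding sum.reindex[OF inj] by (rule cong_sum) (simp add: shift_def cong_def)
  moreover have "(\<Sum>s\<in>B. s + 1) = \<Sum>B + card B"
    using sum.distrib[of "\<lambda>s. s" "\<lambda>_. 1" B] by simp
  ultimately have "[\<Sum>(shift p ` B) = \<Sum>B + card B] (mod p)" by (simp only:)
  then have "[u * \<Sum>(shift p ` B) = u * \<Sum>B + u * card B] (mod p)"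
    by (simp flip: distrib_left add: cong_scalar_left)
  also have "[u * \<Sum>B + u * card B = u * \<Sum>B + 1] (mod p)"
    by (intro cong_add u) simp
  finally have "u * \<Sum>(shift p ` B) mod p = (u * \<Sum>B mod p + 1) mod p"
    by (simp add: cong_def mod_simps)
  moreover have "sign_of p A = u * \<Sum>B mod p" by (simp add: sign_of_def B_def u_def Let_def)
  moreover have "sign_of p (rot p ` A) = u * \<Sum>(shift p ` B) mod p"
    using card_image[OF inj] by (simp add: sign_of_def pc col B_def u_def Let_def)
  ultimately show ?thesis by simp
qed

section \<open>The labeling obtained from a coloring of the Kneser hypergraph\<close>

text \<open>The bijection \<open>g\<close> numbers the vertices, which orders them as the orientation of simplices requires.\<close>

locale kneser_coloring =
  fixes H :: "'a hypergraph" and p t :: nat and c :: "'a set \<Rightarrow> nat" and n :: nat and g :: "nat \<Rightarrow> 'a"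
  assumes hyp: "hypergraph H"
    and nonempty: "{} \<notin> edges H"
    and prime: "prime p"
    and col: "proper_coloring (kneser p H) t c"
    and bij: "bij_betw g {..<n} (verts H)"
begin

lemma p_pos: "p > 0" and p2: "p \<ge> 2"
  using prime prime_gt_0_nat prime_ge_2_nat by auto

definition part :: "(nat \<times> nat) set \<Rightarrow> nat \<Rightarrow> 'a set" where
  "part X s = g ` {i. (i, s) \<in> X}"

definition colors :: "(nat \<times> nat) set \<Rightarrow> nat \<Rightarrow> nat set" where
  "colors X s = c ` {e \<in> edges H. e \<subseteq> part X s}"

definition sizes :: "(nat \<times> nat) set \<Rightarrow> nat \<Rightarrow> nat" where
  "sizes X s = card (colors X s)"

text \<open>The column of a color is the set of the signs whose class contains an edge of that color.\<close>

definition profile :: "(nat \<times> nat) set \<Rightarrow> (nat \<times> nat) set" where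
  "profile X = {(j, s). s < p \<and> j \<in> colors X s}"

text \<open>Levels start at \<open>0\<close>, whence the subtraction of \<open>1\<close>. When \<open>above_min\<close> is nonempty it
  determines the sign, being preserved whenever \<open>X\<close> grows without changing the level; it is placed in
  column \<open>0\<close> so that \<open>sign_of\<close> applies. When it is empty, all classes have equally many colors, and it
  is the profile that is preserved.\<close>

definition label :: "(nat \<times> nat) set \<Rightarrow> nat \<times> nat" where
  "label X =
     (if profile X = {} then (card X - 1, sign_of p X)
      else (n - colorability_defect p H + balanced_size p (sizes X) - 1,
            sign_of p (if above_min p (sizes X) \<noteq> {} then {0} \<times> above_min p (sizes X) else profile X)))"

lemma finite_colors: "finite (colors X s)"
  by (rule finite_subset[of _ "{1..t}"])
     (use col in \<open>auto simp: colors_def proper_coloring_def kneser_def\<close>)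

lemma colors_mono: "X \<subseteq> Y \<Longrightarrow> colors X s \<subseteq> colors Y s"
  by (fastforce simp: colors_def part_def)

lemma part_disjoint:
  assumes "X \<in> simplices p n" "s \<noteq> s'"
  shows "part X s \<inter> part X s' = {}"
proof -
  have "i \<noteq> i'" if "(i, s) \<in> X" "(i', s') \<in> X" for i i'
    using that assms inj_onD[of fst X "(i, s)" "(i', s')"] by (auto simp: simplices_def)
  moreover have "i < n" if "(i, s'') \<in> X" for i s''
    using that assms by (auto simp: simplices_def)
  ultimately show ?thesis
    using bij by (auto simp: part_def bij_betw_def dest!: inj_onD)
qed

lemma kneser_edgeI:
  assumes X: "X \<in> simplices p n"
    and e: "\<And>s. s < p \<Longrightarrow> e s \<in> edges H" "\<And>s. s < p \<Longrightarrow> e s \<subseteq> part X s"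
  shows "(\<lambda>j. e (j - 1)) ` {1..p} \<in> edges (kneser p H)"
proof -
  have "e (i - 1) \<inter> e (j - 1) = {}" if "i \<in> {1..p}" "j \<in> {1..p}" "i \<noteq> j" for i j
    using that e(2)[of "i - 1"] e(2)[of "j - 1"] part_disjoint[OF X, of "i - 1" "j - 1"]
    by fastforce
  moreover have "(\<lambda>j. e (j - 1)) \<in> {1..p} \<rightarrow> edges H" using e(1) by auto
  ultimately show ?thesis
    unfolding kneser_def select_convs mem_Collect_eq by blast
qed

text \<open>If a color occurred in every class, \<open>p\<close> edges of that color, one from each class, would form a
  monochromatic edge of the Kneser hypergraph.\<close>

lemma profile_mixed_column:
  assumes X: "X \<in> simplices p n" and j: "(j, s) \<in> profile X"
  shows "mixed_column p (profile X) j"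
proof -
  have "profile X `` {j} \<noteq> {..<p}"
  proof
    assume "profile X `` {j} = {..<p}"
    then have "\<forall>s<p. j \<in> colors X s" by (auto simp: profile_def set_eq_iff)
    then have "\<forall>s<p. \<exists>e. e \<in> edges H \<and> e \<subseteq> part X s \<and> c e = j"
      unfolding colors_def by blast
    then obtain e where e: "\<And>s. s < p \<Longrightarrow> e s \<in> edges H \<and> e s \<subseteq> part X s \<and> c (e s) = j"
      by metis
    let ?E = "(\<lambda>j. e (j - 1)) ` {1..p}"
    have "?E \<in> edges (kneser p H)" using kneser_edgeI[OF X, of e] e by blast
    moreover have "c ` ?E = {j}"
    proof -
      have "c (e (i - 1)) = j" if "i \<in> {1..p}" for i
      proof -
        have "i - 1 < p" using that by auto
        then show ?thesis using e by blast
      qed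
      moreover have "(1::nat) \<in> {1..p}" using p_pos by simp
      ultimately show ?thesis unfolding image_image by blast
    qed
    ultimately show False using col by (force simp: proper_coloring_def)
  qed
  then show ?thesis using j by (auto simp: mixed_column_def)
qed

lemma defect_le:
  assumes "Y \<subseteq> verts H" "proper_coloring (induced H (verts H - Y)) p f"
  shows "colorability_defect p H \<le> card Y"
proof -
  have "finite (card ` Pow (verts H))" using hyp by (simp add: hypergraph_def)
  then have "finite {card Y |Y. Y \<subseteq> verts H \<and> chromatic_number (induced H (verts H - Y)) \<le> enat p}"
    by (rule rev_finite_subset) auto
  moreover have "chromatic_number (induced H (verts H - Y)) \<le> enat p"
    unfolding chromatic_number_def using assms(2) p_pos by (intro Inf_lower) blast
  ultimately show ?thesis
    unfolding colorability_defect_def using assms(1) by (intro Min_le) auto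
qed

lemma card_verts: "card (verts H) = n"
  using bij_betw_same_card[OF bij] by simp

text \<open>If no class of \<open>X\<close> contains an edge, the signs are a proper coloring of the hypergraph induced on the
  vertices covered by \<open>X\<close>. Hence the number of uncovered vertices is at least the colorability defect.\<close>

lemma card_simplex_le:
  assumes X: "X \<in> simplices p n" and "profile X = {}"
  shows "card X + colorability_defect p H \<le> n"
proof -
  define Y where "Y = verts H - g ` fst ` X"
  have inj: "inj_on fst X" "fst ` X \<subseteq> {..<n}" using X by (auto simp: simplices_def)
  have injg: "inj_on g {..<n}" and gv: "g ` {..<n} = verts H" using bij by (auto simp: bij_betw_def)
  have sub: "g ` fst ` X \<subseteq> verts H" using inj(2) gv by auto
  have "card (g ` fst ` X) = card X"
    using inj inj_on_subset[OF injg inj(2)] by (simp add: card_image)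
  then have cY: "card Y + card X = n"
    using sub hyp card_verts card_mono[OF _ sub] unfolding Y_def
    by (simp add: card_Diff_subset hypergraph_def finite_subset)
  define f where "f v = Suc (THE s. v \<in> part X s)" for v
  have f: "f v = Suc s" if "v \<in> part X s" for v s
    using that part_disjoint[OF X] unfolding f_def by (auto intro!: the_equality)
  have inpart: "\<exists>s<p. v \<in> part X s" if "v \<in> g ` fst ` X" for v
    using that X by (fastforce simp: part_def simplices_def)
  have VY: "verts H - Y = g ` fst ` X" using sub by (auto simp: Y_def)
  have "proper_coloring (induced H (verts H - Y)) p f"
    unfolding proper_coloring_def induced_def VY
  proof (intro conjI ballI)
    fix v assume "v \<in> verts \<lparr>verts = g ` fst ` X, edges = {e \<in> edges H. e \<subseteq> g ` fst ` X}\<rparr>"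
    then obtain s where "s < p" "v \<in> part X s" using inpart by auto
    then show "f v \<in> {1..p}" using f by simp
  next
    fix e assume "e \<in> edges \<lparr>verts = g ` fst ` X, edges = {e \<in> edges H. e \<subseteq> g ` fst ` X}\<rparr>"
    then have e: "e \<in> edges H" "e \<subseteq> g ` fst ` X" by auto
    show "card (f ` e) \<noteq> 1"
    proof
      assume "card (f ` e) = 1"
      then obtain k where k: "f ` e = {k}" by (auto simp: card_1_singleton_iff)
      have "e \<noteq> {}" using e nonempty by auto
      then obtain v where v: "v \<in> e" by auto
      then obtain s where s: "s < p" "v \<in> part X s" using inpart e by blast
      have "e \<subseteq> part X s"
      proof
        fix w assume w: "w \<in> e"
        then obtain s' where s': "s' < p" "w \<in> part X s'" using inpart e by blast
        have "f w \<in> f ` e" "f v \<in> f ` e" using v w by auto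
        then have "f w = f v" using k by simp
        then show "w \<in> part X s" using f[OF s(2)] f[OF s'(2)] s' by simp
      qed
      then have "(c e, s) \<in> profile X" using e s by (auto simp: profile_def colors_def)
      then show False using assms(2) by simp
    qed
  qed
  then have "colorability_defect p H \<le> card Y" by (rule defect_le[rotated]) (auto simp: Y_def)
  then show ?thesis using cY by simp
qed

lemma defect_le_n: "colorability_defect p H \<le> n"
proof -
  have "profile {} = {}" using nonempty by (auto simp: profile_def colors_def part_def)
  then show ?thesis using card_simplex_le[of "{}"] by simp
qed

lemma colors_rot:
  assumes "X \<in> simplices p n" "s < p"
  shows "colors (rot p ` X) (shift p s) = colors X s"
proof -
  have "s' = s" if "(i, s') \<in> X" "shift p s' = shift p s" for i s'
    using that assms inj_onD[OF shift_inj] by (auto simp: simplices_def)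
  then have "(i, shift p s) \<in> rot p ` X \<longleftrightarrow> (i, s) \<in> X" for i
    by (force simp: rot_eq shift_def)
  then show ?thesis by (simp add: colors_def part_def)
qed

lemma profile_rot:
  assumes "X \<in> simplices p n"
  shows "profile (rot p ` X) = rot p ` profile X"
proof -
  have "profile (rot p ` X) = {(j, s) | j s. s \<in> shift p ` {..<p} \<and> j \<in> colors (rot p ` X) s}"
    by (auto simp: profile_def shift_image)
  also have "\<dots> = rot p ` profile X"
    using colors_rot[OF assms] by (force simp: profile_def rot_eq shift_def)
  finally show ?thesis .
qed

lemma balanced_size_sizes_pos: "profile X \<noteq> {} \<Longrightarrow> balanced_size p (sizes X) > 0"
  using finite_colors by (auto simp: profile_def sizes_def card_gt_0_iff intro!: balanced_size_pos)

lemma label_rot: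
  assumes X: "X \<in> simplices p n" "X \<noteq> {}"
  shows "label (rot p ` X) = rot p (label X)"
proof -
  have card: "card (rot p ` X) = card X" by (rule card_image[OF simplex_rot_inj[OF X(1)]])
  have sh: "sizes (rot p ` X) (shift p s) = sizes X s" if "s < p" for s
    using colors_rot[OF X(1) that] by (simp add: sizes_def)
  note lb = balanced_size_shift[of p "sizes (rot p ` X)" "sizes X", OF sh]
  consider (none) "profile X = {}" | (above_min) "profile X \<noteq> {}" "above_min p (sizes X) \<noteq> {}"
    | (flat) "profile X \<noteq> {}" "above_min p (sizes X) = {}" by blast
  then show ?thesis
  proof cases
    case none
    obtain i s where i: "(i, s) \<in> X" using X(2) by auto
    then have "X `` {i} = {s}"
      using X(1) inj_onD[of fst X "(i, s)" "(i, s')" for s'] by (fastforce simp: simplices_def)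
    moreover have "{s} \<noteq> {..<p}"
    proof
      assume "{s} = {..<p}"
      then have "card {s} = card {..<p}" by (rule arg_cong)
      then show False using p2 by simp
    qed
    ultimately have "mixed_column p X i" by (simp add: mixed_column_def)
    then have "sign_of p (rot p ` X) = (sign_of p X + 1) mod p"
      using X(1) by (intro sign_of_rot[OF prime]) (auto simp: simplices_def)
    then show ?thesis using none card by (simp add: label_def profile_rot[OF X(1)] rot_Pair)
  next
    case above_min
    let ?A = "{0::nat} \<times> above_min p (sizes X)"
    have "?A `` {0} = above_min p (sizes X)" by auto
    then have "mixed_column p ?A 0" using above_min above_min_proper[OF p_pos, of "sizes X"] by (auto simp: mixed_column_def)
    then have "sign_of p (rot p ` ?A) = (sign_of p ?A + 1) mod p"
      by (intro sign_of_rot[OF prime]) (auto simp: above_min_def)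
    moreover have "rot p ` ?A = {0} \<times> above_min p (sizes (rot p ` X))"
    proof -
      have "rot p ` ({0} \<times> S) = {0} \<times> shift p ` S" for S
        by (force simp: rot_eq shift_def)
      then show ?thesis by (simp only: lb(2))
    qed
    moreover have "above_min p (sizes (rot p ` X)) \<noteq> {}" using above_min lb(2) by simp
    ultimately show ?thesis using above_min lb(3) by (simp add: label_def profile_rot[OF X(1)] rot_Pair)
  next
    case flat
    then obtain j s where j: "(j, s) \<in> profile X" by auto
    then have "sign_of p (rot p ` profile X) = (sign_of p (profile X) + 1) mod p"
      by (intro sign_of_rot[OF prime _ profile_mixed_column[OF X(1) j]]) (auto simp: profile_def)
    moreover have "above_min p (sizes (rot p ` X)) = {}" using flat lb(2) by simp
    ultimately show ?thesis using flat lb(3) by (simp add: label_def profile_rot[OF X(1)] rot_Pair)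
  qed
qed

text \<open>Levels of assignments without an edge inside a class are below \<open>n - cd\<close>, the other levels are not.
  Within the second kind, an unchanged balanced size means, by \<open>balanced_size_mono\<close>, an unchanged
  minimum and an unchanged \<open>above_min\<close>. If the latter is empty, every class keeps its number of
  colors and therefore its colors, so the profile is unchanged, too.\<close>

lemma label_mono:
  assumes Y: "Y \<in> simplices p n" and X: "X \<noteq> {}" "X \<subseteq> Y"
  shows "fst (label X) < fst (label Y) \<or> label X = label Y"
proof -
  have X': "X \<in> simplices p n" using simplices_mono[OF Y X(2)] .
  have cX: "card X > 0" using simplex_finite[OF X'] X(1) by (simp add: card_gt_0_iff)
  have profile_mono: "profile X \<subseteq> profile Y" using colors_mono[OF X(2)] by (auto simp: profile_def)
  consider (none) "profile X = {}" "profile Y = {}" | (one) "profile X = {}" "profile Y \<noteq> {}"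
    | (both) "profile X \<noteq> {}" "profile Y \<noteq> {}" using profile_mono by blast
  then show ?thesis
  proof cases
    case none
    have "card X < card Y \<or> X = Y"
      using psubset_card_mono[OF simplex_finite[OF Y], of X] X(2) by blast
    then show ?thesis using none cX by (auto simp: label_def)
  next
    case one
    have "card X - 1 < n - colorability_defect p H + balanced_size p (sizes Y) - 1"
      using card_simplex_le[OF X' one(1)] balanced_size_sizes_pos[OF one(2)] cX by linarith
    then show ?thesis using one by (simp add: label_def)
  next
    case both
    have le: "sizes X s \<le> sizes Y s" for s
      unfolding sizes_def by (rule card_mono[OF finite_colors colors_mono[OF X(2)]])
    consider "balanced_size p (sizes X) < balanced_size p (sizes Y)"
      | "min_size p (sizes X) = min_size p (sizes Y)" "above_min p (sizes X) = above_min p (sizes Y)"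
      using balanced_size_mono[OF p_pos, of "sizes X" "sizes Y"] le by blast
    then show ?thesis
    proof cases
      case 1
      then have "fst (label X) < fst (label Y)"
        using both balanced_size_sizes_pos[OF both(1)] by (simp add: label_def diff_less_mono)
      then show ?thesis ..
    next
      case 2
      have "profile X = profile Y" if flat: "above_min p (sizes X) = {}"
      proof -
        have "colors X s = colors Y s" if "s < p" for s
        proof (rule card_subset_eq[OF finite_colors colors_mono[OF X(2)]])
          have "sizes X s = min_size p (sizes X)" "sizes Y s = min_size p (sizes Y)"
            using flat 2(2) that min_size_le[OF that, of "sizes X"] min_size_le[OF that, of "sizes Y"]
            by (auto simp: above_min_def intro: antisym)
          then show "card (colors X s) = card (colors Y s)" using 2(1) by (simp add: sizes_def)
        qed
        then show ?thesis by (auto simp: profile_def)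
      qed
      then show ?thesis using both 2 by (simp add: label_def balanced_size_def)
    qed
  qed
qed

text \<open>Otherwise all labels have a level below \<open>n - 1\<close>, against \<open>dimension_le\<close>.\<close>

lemma ex_balanced_simplex:
  "\<exists>X\<in>simplices p n. colorability_defect p H \<le> balanced_size p (sizes X)"
proof (rule ccontr)
  assume "\<not> ?thesis"
  then have small: "balanced_size p (sizes X) < colorability_defect p H" if "X \<in> simplices p n" for X
    using that not_le by blast
  from small[of "{}"] have cd: "0 < colorability_defect p H" by simp
  interpret equivariant_labeling p n "n - 1" label
  proof
    fix X assume X: "X \<in> simplices p n" "X \<noteq> {}"
    have "card X > 0" using simplex_finite[OF X(1)] X(2) by (simp add: card_gt_0_iff)
    have "fst (label X) < n - 1"
    proof (cases "profile X = {}")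
      case True
      have "card X - 1 < n - 1" using card_simplex_le[OF X(1) True] cd \<open>card X > 0\<close> by linarith
      then show ?thesis using True by (simp add: label_def)
    next
      case False
      have "n - colorability_defect p H + balanced_size p (sizes X) - 1 < n - 1"
        using small[OF X(1)] balanced_size_sizes_pos[OF False] defect_le_n by linarith
      then show ?thesis using False by (simp add: label_def)
    qed
    moreover have "snd (label X) < p" using sign_of_less[OF p_pos] by (simp add: label_def)
    ultimately show "label X \<in> {..<n - 1} \<times> {..<p}" by (simp add: mem_Times_iff)
  qed (use p2 label_rot label_mono in auto)
  show False using dimension_le cd defect_le_n by simp
qed

end

section \<open>Colorful complete partite subhypergraphs\<close>

theorem theorem1:
  fixes H :: "'a hypergraph" and p t :: nat and c :: "'a set \<Rightarrow> nat"
  assumes "hypergraph H"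
    and "{} \<notin> edges H"
    and "prime p"
    and "t > 0"
    and "proper_coloring (kneser p H) t c"
  shows "\<exists>U. contains_complete_partite (kneser p H) p U \<and>
           (\<Sum>j=1..p. card (U j)) = colorability_defect p H \<and>
           (\<forall>i\<in>{1..p}. \<forall>j\<in>{1..p}. card (U i) \<le> card (U j) + 1) \<and>
           (\<forall>j\<in>{1..p}. inj_on c (U j))"
proof -
  have "finite (verts H)" using assms(1) by (simp add: hypergraph_def)
  then obtain g where "bij_betw g {..<card (verts H)} (verts H)"
    using ex_bij_betw_nat_finite by (auto simp: atLeast0LessThan)
  then interpret kneser_coloring H p t c "card (verts H)" g
    by unfold_locales (use assms in auto)
  let ?n = "card (verts H)"
  obtain X where X: "X \<in> simplices p ?n" "colorability_defect p H \<le> balanced_size p (sizes X)"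
    using ex_balanced_simplex by blast
  obtain k where k: "\<And>s. s < p \<Longrightarrow> k s \<le> sizes X s" "(\<Sum>s<p. k s) = colorability_defect p H"
      "\<And>i j. i < p \<Longrightarrow> j < p \<Longrightarrow> k i \<le> k j + 1"
    using balanced_choice[OF p_pos X(2)] by blast
  \<comment> \<open>One edge for each of \<open>k s\<close> colors of class \<open>s\<close>.\<close>
  have "\<exists>W. W \<subseteq> {e \<in> edges H. e \<subseteq> part X s} \<and> inj_on c W \<and> card W = k s" if "s < p" for s
  proof -
    from k(1)[OF that] obtain C where C: "C \<subseteq> colors X s" "card C = k s"
      unfolding sizes_def by (rule obtain_subset_with_card_n)
    obtain W where "W \<subseteq> {e \<in> edges H. e \<subseteq> part X s}" "inj_on c W" "C = c ` W"
      using C(1) unfolding colors_def by (meson subset_image_inj)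
    then show ?thesis using C(2) card_image by metis
  qed
  then obtain W where W: "\<And>s. s < p \<Longrightarrow> W s \<subseteq> {e \<in> edges H. e \<subseteq> part X s}"
      "\<And>s. s < p \<Longrightarrow> inj_on c (W s)" "\<And>s. s < p \<Longrightarrow> card (W s) = k s"
    by metis
  \<comment> \<open>Signs start at \<open>0\<close>, parts are numbered from \<open>1\<close>.\<close>
  define U where "U j = W (j - 1)" for j
  have less: "j - 1 < p" if "j \<in> {1..p}" for j using that by auto
  have disj: "U i \<inter> U j = {}" if "i \<in> {1..p}" "j \<in> {1..p}" "i \<noteq> j" for i j
  proof -
    have "i - 1 \<noteq> j - 1" using that by auto
    then have "part X (i - 1) \<inter> part X (j - 1) = {}" by (rule part_disjoint[OF X(1)])
    then have "e = {}" if "e \<in> U i" "e \<in> U j" for e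
      using that W(1)[OF less[OF \<open>i \<in> {1..p}\<close>]] W(1)[OF less[OF \<open>j \<in> {1..p}\<close>]]
      unfolding U_def by blast
    then show ?thesis
      using W(1)[OF less[OF that(1)]] assms(2) unfolding U_def by blast
  qed
  have edge: "u ` {1..p} \<in> edges (kneser p H)" if u: "\<forall>i\<in>{1..p}. u i \<in> U i" for u
  proof -
    have "u (Suc s) \<in> edges H \<and> u (Suc s) \<subseteq> part X s" if "s < p" for s
      using u[rule_format, of "Suc s"] W(1)[OF that] that by (auto simp: U_def)
    then have "(\<lambda>j. u (Suc (j - 1))) ` {1..p} \<in> edges (kneser p H)"
      using kneser_edgeI[OF X(1), of "\<lambda>s. u (Suc s)"] by blast
    moreover have "(\<lambda>j. u (Suc (j - 1))) ` {1..p} = u ` {1..p}" by (rule image_cong) auto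
    ultimately show ?thesis by simp
  qed
  have "U i \<subseteq> edges H" if "i \<in> {1..p}" for i using W(1)[OF less[OF that]] by (auto simp: U_def)
  then have "contains_complete_partite (kneser p H) p U"
    using disj edge by (auto simp: contains_complete_partite_def disjoint_family_on_def kneser_def)
  moreover have "(\<Sum>j=1..p. card (U j)) = (\<Sum>s<p. k s)"
    using W(3) by (intro sum.reindex_bij_witness[of _ Suc "\<lambda>j. j - 1"]) (auto simp: U_def)
  moreover have "\<forall>i\<in>{1..p}. \<forall>j\<in>{1..p}. card (U i) \<le> card (U j) + 1"
    using W(3)[OF less] k(3)[OF less less] by (simp add: U_def)
  moreover have "\<forall>j\<in>{1..p}. inj_on c (U j)" using W(2)[OF less] by (simp add: U_def)
  ultimately show ?thesis using k(2) by auto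
qed

end
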